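(* Let $v$ be a three-dimensional formal vector field without constant part whose linear part is a scalar multiple of ${\rm N}=x\frac{\partial}{\partial y}+2y\frac{\partial}{\partial z}$. Then ${\rm div}(v)=0$ and $v(\Delta)=0$ both hold if and only if $v\in\mathscr{B}$.
   Context: Work over $\mathbb{R}$ with coordinates $(x,y,z)$ and $\Delta:=xz-y^2$. Vector fields (with polynomial or formal power series coefficients) are identified with derivations, with bracket $[v,w]=vw-wv$ and ${\rm ad}_v w=[v,w]$. Let ${\rm N}=x\frac{\partial}{\partial y}+2y\frac{\partial}{\partial z}$, ${\rm M}=z\frac{\partial}{\partial y}+2y\frac{\partial}{\partial x}$, and $\kappa_{l,m}:=\frac{m!}{(m-l)!}$. For integers $i,k\ge 0$, $-1\le l\le 2i+1$, define $${\rm B}^l_{i,k}:=\frac{{\rm ad}_{\rm N}^{\,l+1}(z^i\Delta^k{\rm M})}{\kappa_{l+1,2i+2}}.$$ In particular ${\rm B}^1_{0,0}=-{\rm N}$. The space $\mathscr{B}$ consists of all formal vector fields $c\,{\rm B}^1_{0,0}+\sum b^l_{i,k}{\rm B}^l_{i,k}$ with $c,b^l_{i,k}\in\mathbb R$, the (possibly infinite) sum being over $i,k\ge0$ with $i+2k\ge1$ and $-1\le l\le 2i+1$. *)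

theory Defs
  imports "HOL-Computational_Algebra.Formal_Power_Series" "HOL-Library.Product_Plus"
begin

unbundle fps_syntax

text \<open>
  The ring of formal power series in three variables is the iterated ring
  \<open>R[[x]][[y]][[z]]\<close>: the innermost layer carries \<open>x\<close>, the outermost one \<open>z\<close>.
\<close>

type_synonym series = "real fps fps fps"

definition coeff3 :: "series \<Rightarrow> nat \<Rightarrow> nat \<Rightarrow> nat \<Rightarrow> real" where
  "coeff3 f p q r = f $ r $ q $ p"  \<comment> \<open>coefficient of \<open>x^p y^q z^r\<close>\<close>

definition const3 :: "real \<Rightarrow> series" where
  "const3 c = fps_const (fps_const (fps_const c))"

definition var_x :: series where "var_x = fps_const (fps_const fps_X)"
definition var_y :: series where "var_y = fps_const fps_X"
definition var_z :: series where "var_z = fps_X"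

definition Delta :: series where
  "Delta = var_x * var_z - var_y ^ 2"

definition diff_x :: "series \<Rightarrow> series" where
  "diff_x f = Abs_fps (\<lambda>r. Abs_fps (\<lambda>q. fps_deriv (f $ r $ q)))"

definition diff_y :: "series \<Rightarrow> series" where
  "diff_y f = Abs_fps (\<lambda>r. fps_deriv (f $ r))"

definition diff_z :: "series \<Rightarrow> series" where
  "diff_z f = fps_deriv f"

definition series_part :: "nat \<Rightarrow> series \<Rightarrow> series" where
  "series_part d f =
     Abs_fps (\<lambda>r. Abs_fps (\<lambda>q. Abs_fps (\<lambda>p. if p + q + r = d then coeff3 f p q r else 0)))"
  \<comment> \<open>homogeneous part of total degree \<open>d\<close>\<close>

text \<open>
  The triple \<open>(f, g, h)\<close> stands for the vector field with \<open>d/dx\<close>, \<open>d/dy\<close>, \<open>d/dz\<close>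
  components \<open>f\<close>, \<open>g\<close>, \<open>h\<close>.
\<close>

type_synonym vfield = "series \<times> series \<times> series"

fun vf_apply :: "vfield \<Rightarrow> series \<Rightarrow> series" where
  "vf_apply (f, g, h) u = f * diff_x u + g * diff_y u + h * diff_z u"

fun vf_mult :: "series \<Rightarrow> vfield \<Rightarrow> vfield" where
  "vf_mult u (f, g, h) = (u * f, u * g, u * h)"

definition vf_scale :: "real \<Rightarrow> vfield \<Rightarrow> vfield" where
  "vf_scale c v = vf_mult (const3 c) v"

fun divergence :: "vfield \<Rightarrow> series" where
  "divergence (f, g, h) = diff_x f + diff_y g + diff_z h"

fun vf_part :: "nat \<Rightarrow> vfield \<Rightarrow> vfield" where
  "vf_part d (f, g, h) = (series_part d f, series_part d g, series_part d h)"

text \<open>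
  The components of \<open>[v, w] = vw - wv\<close> are its values at the coordinate functions;
  \<open>vf_apply_bracket\<close> below states the defining identity of derivations.
\<close>

fun bracket :: "vfield \<Rightarrow> vfield \<Rightarrow> vfield" where
  "bracket v (f, g, h) =
     (case v of (f', g', h') \<Rightarrow>
       (vf_apply v f - vf_apply (f, g, h) f',
        vf_apply v g - vf_apply (f, g, h) g',
        vf_apply v h - vf_apply (f, g, h) h'))"

definition vfN :: vfield where
  "vfN = (0, var_x, 2 * var_y)"

definition vfM :: vfield where
  "vfM = (2 * var_y, var_z, 0)"

definition kappa :: "nat \<Rightarrow> nat \<Rightarrow> real" where
  "kappa l m = fact m / fact (m - l)"

definition vfB :: "int \<Rightarrow> nat \<Rightarrow> nat \<Rightarrow> vfield" where
  "vfB l i k =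
     vf_scale (1 / kappa (nat (l + 1)) (2 * i + 2))
       ((bracket vfN ^^ nat (l + 1)) (vf_mult (var_z ^ i * Delta ^ k) vfM))"

text \<open>
  Formal (coefficientwise) summation: each coefficient receives only finitely many
  nonzero contributions from the family.
\<close>

definition series_has_sum :: "('i \<Rightarrow> series) \<Rightarrow> 'i set \<Rightarrow> series \<Rightarrow> bool" where
  "series_has_sum F I s \<longleftrightarrow>
     (\<forall>p q r. finite {j \<in> I. coeff3 (F j) p q r \<noteq> 0} \<and>
        coeff3 s p q r = (\<Sum>j | j \<in> I \<and> coeff3 (F j) p q r \<noteq> 0. coeff3 (F j) p q r))"

definition vf_has_sum :: "('i \<Rightarrow> vfield) \<Rightarrow> 'i set \<Rightarrow> vfield \<Rightarrow> bool" where
  "vf_has_sum F I v \<longleftrightarrow>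
     series_has_sum (\<lambda>j. fst (F j)) I (fst v) \<and>
     series_has_sum (\<lambda>j. fst (snd (F j))) I (fst (snd v)) \<and>
     series_has_sum (\<lambda>j. snd (snd (F j))) I (snd (snd v))"

definition B_index :: "(int \<times> nat \<times> nat) set" where
  "B_index = {(l, i, k). 1 \<le> i + 2 * k \<and> -1 \<le> l \<and> l \<le> 2 * int i + 1}"

definition B_space :: "vfield set" where
  "B_space = {v. \<exists>(c::real) (b :: int \<Rightarrow> nat \<Rightarrow> nat \<Rightarrow> real) w.
     vf_has_sum (\<lambda>(l, i, k). vf_scale (b l i k) (vfB l i k)) B_index w \<and>
     v = vf_scale c (vfB 1 0 0) + w}"


lemma Abs_fps_map_mult:
  fixes D :: "'a::comm_ring_1 \<Rightarrow> 'a"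
  assumes add: "\<And>a b. D (a + b) = D a + D b"
    and mult: "\<And>a b. D (a * b) = a * D b + D a * b"
  shows "Abs_fps (\<lambda>n. D ((f * g) $ n)) =
     f * Abs_fps (\<lambda>n. D (g $ n)) + Abs_fps (\<lambda>n. D (f $ n)) * g"
proof -
  have D0: "D 0 = 0" using add[of 0 0] by simp
  have "D (sum h S) = (\<Sum>j\<in>S. D (h j))" if "finite S" for h :: "nat \<Rightarrow> 'a" and S
    using that by (induction S rule: finite_induct) (simp_all add: add D0)
  then show ?thesis
    by (simp add: fps_eq_iff fps_mult_nth mult sum.distrib)
qed

lemma diff_add [simp]:
  "diff_x (f + g) = diff_x f + diff_x g"
  "diff_y (f + g) = diff_y f + diff_y g"
  "diff_z (f + g) = diff_z f + diff_z g"
  by (simp_all add: diff_x_def diff_y_def diff_z_def fps_eq_iff distrib_left)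

lemma diff_mult [simp]:
  "diff_x (f * g) = f * diff_x g + diff_x f * g"
  "diff_y (f * g) = f * diff_y g + diff_y f * g"
  "diff_z (f * g) = f * diff_z g + diff_z f * g"
proof -
  let ?D = "\<lambda>a :: real fps fps. Abs_fps (\<lambda>q. fps_deriv (a $ q))"
  have "?D (a * b) = a * ?D b + ?D a * b" for a b
    by (rule Abs_fps_map_mult) (simp_all add: mult.commute)
  moreover have "?D (a + b) = ?D a + ?D b" for a b
    by (simp add: fps_eq_iff distrib_left)
  ultimately show "diff_x (f * g) = f * diff_x g + diff_x f * g"
    unfolding diff_x_def by (rule Abs_fps_map_mult[where D = ?D, rotated])
  show "diff_y (f * g) = f * diff_y g + diff_y f * g"
    unfolding diff_y_def by (rule Abs_fps_map_mult) simp_all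
  show "diff_z (f * g) = f * diff_z g + diff_z f * g"
    by (simp add: diff_z_def)
qed

lemma diff_nth:
  "diff_x f $ r $ q $ p = of_nat (Suc p) * f $ r $ q $ Suc p"
  "diff_y f $ r $ q $ p = of_nat (Suc q) * f $ r $ Suc q $ p"
  "diff_z f $ r $ q $ p = of_nat (Suc r) * f $ Suc r $ q $ p"
proof -
  have 1: "(of_nat n * a) $ k = of_nat n * a $ k" for n k and a :: "real fps"
    by (metis fps_of_nat fps_mult_left_const_nth)
  have 2: "(of_nat n * a) $ k = of_nat n * a $ k" for n k and a :: "real fps fps"
    by (metis fps_of_nat fps_mult_left_const_nth)
  show "diff_x f $ r $ q $ p = of_nat (Suc p) * f $ r $ q $ Suc p"
    by (simp add: diff_x_def)
  show "diff_y f $ r $ q $ p = of_nat (Suc q) * f $ r $ Suc q $ p"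
    by (simp only: diff_y_def fps_deriv_nth fps_nth_Abs_fps 1 Suc_eq_plus1)
  show "diff_z f $ r $ q $ p = of_nat (Suc r) * f $ Suc r $ q $ p"
    by (simp only: diff_z_def fps_deriv_nth 2 1 Suc_eq_plus1)
qed

lemma diff_commute:
  "diff_y (diff_x f) = diff_x (diff_y f)"
  "diff_z (diff_x f) = diff_x (diff_z f)"
  "diff_z (diff_y f) = diff_y (diff_z f)"
  by (simp_all only: fps_eq_iff diff_nth mult.left_commute simp_thms)

lemma vf_apply_bracket:
  "vf_apply (bracket v w) u = vf_apply v (vf_apply w u) - vf_apply w (vf_apply v u)"
  by (cases v; cases w) (simp add: diff_commute algebra_simps)

lemma diff_var [simp]:
  "diff_x var_x = 1" "diff_y var_x = 0" "diff_z var_x = 0"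
  "diff_x var_y = 0" "diff_y var_y = 1" "diff_z var_y = 0"
  "diff_x var_z = 0" "diff_y var_z = 0" "diff_z var_z = 1"
  by (simp_all add: diff_x_def diff_y_def diff_z_def var_x_def var_y_def var_z_def fps_eq_iff)

lemma diff_0_minus [simp]:
  "diff_x 0 = 0" "diff_y 0 = 0" "diff_z 0 = 0"
  "diff_x (- f) = - diff_x f" "diff_y (- f) = - diff_y f" "diff_z (- f) = - diff_z f"
  by (simp_all add: diff_x_def diff_y_def diff_z_def fps_eq_iff)

lemma diff_2 [simp]: "diff_x 2 = 0" "diff_y 2 = 0" "diff_z 2 = 0"
proof -
  have "diff_x 1 = 0" "diff_y 1 = 0" "diff_z 1 = 0"
    by (simp_all add: diff_x_def diff_y_def diff_z_def fps_eq_iff)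
  then show "diff_x 2 = 0" "diff_y 2 = 0" "diff_z 2 = 0"
    by (simp_all only: one_add_one[symmetric] diff_add add_0_left)
qed

lemma vfB_1_0_0: "vfB 1 0 0 = - vfN"
proof -
  have 1: "bracket vfN vfM = (2 * var_x, 0, - (2 * var_z))"
    by (simp add: vfN_def vfM_def)
  have 2: "bracket vfN (bracket vfN vfM) = (0, - (2 * var_x), - (2 * (2 * var_y)))"
    unfolding 1 by (simp add: vfN_def)
  have "const3 (1 / 2) * 2 = 1"
    by (simp only: const3_def numeral_fps_const fps_const_mult) simp
  then have 3: "const3 (1 / 2) * (2 * f) = f" for f
    by (metis mult.assoc mult_1)
  have 4: "(bracket vfN ^^ 2) w = bracket vfN (bracket vfN w)" for w
    by (simp only: numeral_2_eq_2 funpow.simps o_apply id_apply)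
  have 5: "vf_mult (var_z ^ 0 * Delta ^ 0) vfM = vfM"
    by (simp add: vfM_def)
  have 6: "kappa 2 (2 * 0 + 2) = 2" "nat (1 + 1) = 2"
    by (simp_all add: kappa_def)
  show ?thesis
    unfolding vfB_def 5 6 4 2 vf_scale_def vf_mult.simps mult_minus_right 3
    by (simp add: vfN_def)
qed

end

(*
  Restrict to the cone Delta = 0, parametrised by (s^2, s t, t^2).  Tangency to the level sets of
  Delta together with div v = 0 gives M f + N h = 2 g for v = (f, g, h), so that a homogeneous v of
  degree n is determined modulo Delta by 2 n + 1 coefficients of its restriction; with respect to
  these, the fields ad_N^j (z^(n-1) M), 0 <= j <= 2 n, form a dual basis up to nonzero factors.
  Subtracting the corresponding combination of the B^l_(n-1,0) leaves Delta w, where w again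
  satisfies both conditions because w(Delta) Delta = 0 and div (Delta w) = w(Delta) + Delta div w.
  Since Delta B^l_(i,k) = B^l_(i,k+1), induction on the degree concludes.
*)

theory Submission
  imports Defs
begin

subsection \<open>Coefficients and derivatives\<close>

lemma coeff3_arith [simp]:
  "coeff3 0 p q r = 0"
  "coeff3 (f + g) p q r = coeff3 f p q r + coeff3 g p q r"
  "coeff3 (f - g) p q r = coeff3 f p q r - coeff3 g p q r"
  "coeff3 (- f) p q r = - coeff3 f p q r"
  "coeff3 (const3 c * f) p q r = c * coeff3 f p q r"
  by (simp_all add: coeff3_def const3_def)

lemma const3_2: "const3 2 = 2"
  by (simp only: const3_def numeral_fps_const)

lemma coeff3_two_mult [simp]: "coeff3 (2 * f) p q r = 2 * coeff3 f p q r"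
  using coeff3_arith(5)[of 2 f p q r] by (simp only: const3_2)

lemma coeff3_sum: "coeff3 (sum F A) p q r = (\<Sum>j\<in>A. coeff3 (F j) p q r)"
  by (induction A rule: infinite_finite_induct) simp_all

lemma coeff3_var_mult [simp]:
  "coeff3 (var_x * f) p q r = (if p = 0 then 0 else coeff3 f (p - 1) q r)"
  "coeff3 (var_y * f) p q r = (if q = 0 then 0 else coeff3 f p (q - 1) r)"
  "coeff3 (var_z * f) p q r = (if r = 0 then 0 else coeff3 f p q (r - 1))"
  by (simp_all add: coeff3_def var_x_def var_y_def var_z_def)

lemma coeff3_diff [simp]:
  "coeff3 (diff_x f) p q r = real (Suc p) * coeff3 f (Suc p) q r"
  "coeff3 (diff_y f) p q r = real (Suc q) * coeff3 f p (Suc q) r"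
  "coeff3 (diff_z f) p q r = real (Suc r) * coeff3 f p q (Suc r)"
  by (simp_all only: coeff3_def diff_nth)

lemma coeff3_series_part [simp]:
  "coeff3 (series_part d f) p q r = (if p + q + r = d then coeff3 f p q r else 0)"
  by (simp add: coeff3_def series_part_def)

lemma series_eqI: "(\<And>p q r. coeff3 f p q r = coeff3 g p q r) \<Longrightarrow> f = g"
  by (simp add: coeff3_def fps_eq_iff)

lemma diff_const3_mult [simp]:
  "diff_x (const3 c * f) = const3 c * diff_x f"
  "diff_y (const3 c * f) = const3 c * diff_y f"
  "diff_z (const3 c * f) = const3 c * diff_z f"
  by (rule series_eqI; simp del: diff_mult)+

lemma diff_1 [simp]: "diff_x 1 = 0" "diff_y 1 = 0" "diff_z 1 = 0"
  by (simp_all add: diff_x_def diff_y_def diff_z_def fps_eq_iff)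

lemma diff_diff [simp]:
  "diff_x (f - g) = diff_x f - diff_x g"
  "diff_y (f - g) = diff_y f - diff_y g"
  "diff_z (f - g) = diff_z f - diff_z g"
  by (rule series_eqI; simp add: algebra_simps)+

text \<open>The actions of N and M on series. After the substitution (x, y, z) = (s^2, s t, t^2)
  they become s d/dt and t d/ds.\<close>

definition lie_N :: "series \<Rightarrow> series" where
  "lie_N f = var_x * diff_y f + 2 * (var_y * diff_z f)"

definition lie_M :: "series \<Rightarrow> series" where
  "lie_M f = var_z * diff_y f + 2 * (var_y * diff_x f)"

lemma bracket_vfN: "bracket vfN (f, g, h) = (lie_N f, lie_N g - f, lie_N h - 2 * g)"
  by (simp add: vfN_def lie_N_def algebra_simps)

lemma vf_apply_Delta:
  "vf_apply (f, g, h) Delta = var_z * f - 2 * (var_y * g) + var_x * h"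
  by (simp add: Delta_def power2_eq_square algebra_simps)

lemma vf_apply_vfN_Delta: "vf_apply vfN Delta = 0"
  by (simp add: vfN_def vf_apply_Delta algebra_simps del: vf_apply.simps)

subsection \<open>Divergence-free fields annihilating \<open>\<Delta>\<close>\<close>

definition tangent_div_free :: "vfield \<Rightarrow> bool" where
  "tangent_div_free v \<longleftrightarrow> divergence v = 0 \<and> vf_apply v Delta = 0"

lemma divergence_vf_mult: "divergence (vf_mult u v) = u * divergence v + vf_apply v u"
  by (cases v) (simp add: algebra_simps)

lemma vf_apply_vf_mult: "vf_apply (vf_mult u v) w = u * vf_apply v w"
  by (cases v) (simp add: algebra_simps)

lemma tangent_div_free_0 [simp]: "tangent_div_free 0"
  by (simp add: tangent_div_free_def zero_prod_def)

lemma tangent_div_free_add: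
  "tangent_div_free u \<Longrightarrow> tangent_div_free v \<Longrightarrow> tangent_div_free (u + v)"
proof (cases u, cases v, goal_cases)
  case (1 f g h f' g' h')
  have "divergence (u + v) = divergence u + divergence v"
    "vf_apply (u + v) Delta = vf_apply u Delta + vf_apply v Delta"
    by (simp_all add: 1 algebra_simps)
  with 1(1,2) show ?case
    unfolding tangent_div_free_def by simp
qed

lemma tangent_div_free_scale: "tangent_div_free v \<Longrightarrow> tangent_div_free (vf_scale c v)"
proof -
  assume v: "tangent_div_free v"
  have c: "diff_x (const3 c) = 0" "diff_y (const3 c) = 0" "diff_z (const3 c) = 0"
    using diff_const3_mult[of c 1]
    by (simp_all add: diff_x_def diff_y_def diff_z_def const3_def fps_eq_iff)
  then have "vf_apply v (const3 c) = 0"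
    by (cases v) simp
  with v show ?thesis
    by (simp add: tangent_div_free_def vf_scale_def divergence_vf_mult vf_apply_vf_mult)
qed

lemma tangent_div_free_diff:
  "tangent_div_free u \<Longrightarrow> tangent_div_free v \<Longrightarrow> tangent_div_free (u - v)"
proof -
  have "u - v = u + vf_scale (-1) v"
    by (cases u; cases v) (auto simp: vf_scale_def intro!: series_eqI)
  then show "tangent_div_free u \<Longrightarrow> tangent_div_free v \<Longrightarrow> ?thesis"
    by (simp only: tangent_div_free_add tangent_div_free_scale)
qed

lemma tangent_div_free_sum:
  "(\<And>j. j \<in> A \<Longrightarrow> tangent_div_free (F j)) \<Longrightarrow> tangent_div_free (sum F A)"
  by (induction A rule: infinite_finite_induct) (simp_all add: tangent_div_free_add)

text \<open>Since N has divergence 0, div [N, v] = N(div v); since N(\<Delta>) = 0, [N, v](\<Delta>)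
  = N(v(\<Delta>)).\<close>

lemma tangent_div_free_bracket_vfN:
  assumes "tangent_div_free v" shows "tangent_div_free (bracket vfN v)"
proof (cases v)
  case (fields f g h)
  have "divergence (bracket vfN v) = lie_N (divergence v)"
    by (simp add: fields bracket_vfN lie_N_def diff_commute algebra_simps del: bracket.simps)
  moreover have "vf_apply u 0 = 0" for u
    by (cases u) simp
  ultimately show ?thesis
    using assms by (simp add: tangent_div_free_def vf_apply_bracket vf_apply_vfN_Delta lie_N_def)
qed

lemma Delta_nonzero: "Delta \<noteq> 0"
proof
  assume "Delta = 0"
  then have "diff_z (diff_x Delta) = 0" by simp
  moreover have "diff_z (diff_x Delta) = 1"
    by (simp add: Delta_def power2_eq_square)
  ultimately show False by simp
qed

text \<open>The direction from left to right cancels \<Delta>, which is possible because the series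
  form an integral domain.\<close>

lemma tangent_div_free_Delta_mult:
  "tangent_div_free (vf_mult Delta v) \<longleftrightarrow> tangent_div_free v"
  by (auto simp: tangent_div_free_def divergence_vf_mult vf_apply_vf_mult Delta_nonzero)

text \<open>M has no d/dz component, so it annihilates z^i; moreover div M = 0 and M(\<Delta>) =
  0.\<close>

lemma tangent_div_free_generator: "tangent_div_free (vf_mult (var_z ^ i) vfM)"
proof -
  have "diff_x (var_z ^ i) = 0" "diff_y (var_z ^ i) = 0"
    by (induction i) simp_all
  then have "vf_apply vfM (var_z ^ i) = 0"
    by (simp add: vfM_def)
  moreover have "vf_apply vfM Delta = 0"
    by (simp add: vfM_def vf_apply_Delta algebra_simps del: vf_apply.simps)
  ultimately show ?thesis
    by (simp add: tangent_div_free_def divergence_vf_mult vf_apply_vf_mult) (simp add: vfM_def)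
qed

section \<open>Homogeneous components\<close>

lemma vf_part_arith:
  "vf_part n (u + v) = vf_part n u + vf_part n v"
  "vf_part n (u - v) = vf_part n u - vf_part n v"
  "vf_part n 0 = 0"
  "vf_part n (vf_scale c v) = vf_scale c (vf_part n v)"
  by (cases u; cases v; auto simp: vf_scale_def zero_prod_def intro!: series_eqI)+

lemma vf_part_sum: "vf_part n (sum F A) = (\<Sum>j\<in>A. vf_part n (F j))"
  by (induction A rule: infinite_finite_induct) (simp_all add: vf_part_arith)

lemma vf_part_vf_part: "vf_part n (vf_part m v) = (if n = m then vf_part n v else 0)"
  by (cases v) (auto simp: zero_prod_def intro!: series_eqI)

lemma divergence_vf_part: "divergence (vf_part (Suc n) v) = series_part n (divergence v)"
  "divergence (vf_part 0 v) = 0"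
  by (cases v; auto intro!: series_eqI)+

lemma series_part_arith:
  "series_part (Suc n) (var_x * f) = var_x * series_part n f"
  "series_part (Suc n) (var_y * f) = var_y * series_part n f"
  "series_part (Suc n) (var_z * f) = var_z * series_part n f"
  "series_part n (f + g) = series_part n f + series_part n g"
  "series_part n (f - g) = series_part n f - series_part n g"
  "series_part n (2 * f) = 2 * series_part n f"
  by (rule series_eqI; auto)+

lemma vf_apply_Delta_vf_part:
  "vf_apply (vf_part n v) Delta = series_part (Suc n) (vf_apply v Delta)"
  by (cases v) (simp add: vf_apply_Delta series_part_arith del: vf_apply.simps)

text \<open>Both conditions are graded: the divergence lowers the degree by one, and v \<mapsto>
  v(\<Delta>) raises it by one.\<close>

lemma tangent_div_free_iff_parts:
  "tangent_div_free v \<longleftrightarrow> (\<forall>n. tangent_div_free (vf_part n v))"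
proof
  assume *: "\<forall>n. tangent_div_free (vf_part n v)"
  have "divergence v = 0"
  proof (rule series_eqI)
    fix p q r
    have "series_part (p + q + r) (divergence v) = 0"
      using * by (metis divergence_vf_part(1) tangent_div_free_def)
    then show "coeff3 (divergence v) p q r = coeff3 0 p q r"
      by (metis coeff3_series_part coeff3_arith(1))
  qed
  moreover have "vf_apply v Delta = 0"
  proof (rule series_eqI)
    fix p q r
    have part: "series_part (Suc n) (vf_apply v Delta) = 0" for n
      using * by (metis vf_apply_Delta_vf_part tangent_div_free_def)
    show "coeff3 (vf_apply v Delta) p q r = coeff3 0 p q r"
    proof (cases "p + q + r")
      \<comment> \<open>No part of v accounts for the constant term; it vanishes because every
        summand of v(\<Delta>) contains a variable as a factor.\<close>
      case 0
      then show ?thesis by (cases v) (simp add: vf_apply_Delta del: vf_apply.simps)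
    next
      case (Suc n)
      then show ?thesis by (metis part coeff3_series_part coeff3_arith(1))
    qed
  qed
  ultimately show "tangent_div_free v" by (simp add: tangent_div_free_def)
next
  assume *: "tangent_div_free v"
  show "\<forall>n. tangent_div_free (vf_part n v)"
  proof
    fix n
    have "series_part m 0 = 0" for m by (rule series_eqI) simp
    with * show "tangent_div_free (vf_part n v)"
      by (cases n) (simp_all add: tangent_div_free_def divergence_vf_part vf_apply_Delta_vf_part)
  qed
qed

definition homogeneous :: "nat \<Rightarrow> series \<Rightarrow> bool" where
  "homogeneous n f \<longleftrightarrow> series_part n f = f"

lemma homogeneous_iff: "homogeneous n f \<longleftrightarrow> (\<forall>p q r. p + q + r \<noteq> n \<longrightarrow> coeff3 f p q r = 0)"
  unfolding homogeneous_def
  by (metis (no_types) coeff3_series_part series_eqI)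

lemma vf_part_eq_iff:
  "vf_part n (f, g, h) = (f, g, h) \<longleftrightarrow> homogeneous n f \<and> homogeneous n g \<and> homogeneous n h"
  by (simp add: homogeneous_def)

lemma homogeneous_var_mult:
  assumes "homogeneous n f"
  shows "homogeneous (Suc n) (var_x * f)" "homogeneous (Suc n) (var_y * f)"
    "homogeneous (Suc n) (var_z * f)"
  using assms by (auto simp: homogeneous_iff)

lemma homogeneous_arith:
  "homogeneous n f \<Longrightarrow> homogeneous n g \<Longrightarrow> homogeneous n (f - g)"
  "homogeneous n f \<Longrightarrow> homogeneous n (2 * f)"
  "homogeneous n 0"
  by (auto simp: homogeneous_iff)

lemma homogeneous_lie_N: "homogeneous n f \<Longrightarrow> homogeneous n (lie_N f)"
  by (auto simp: homogeneous_iff lie_N_def)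

lemma homogeneous_Delta_mult: "homogeneous n f \<Longrightarrow> homogeneous (n + 2) (Delta * f)"
  unfolding Delta_def power2_eq_square left_diff_distrib mult.assoc
  by (simp add: homogeneous_var_mult homogeneous_arith)

lemma vf_part_bracket_vfN: "vf_part n v = v \<Longrightarrow> vf_part n (bracket vfN v) = bracket vfN v"
proof (cases v)
  case (fields f g h)
  assume "vf_part n v = v"
  then show ?thesis
    unfolding fields bracket_vfN vf_part_eq_iff by (simp add: homogeneous_lie_N homogeneous_arith)
qed

lemma vf_part_Delta_mult:
  "vf_part n v = v \<Longrightarrow> vf_part (n + 2) (vf_mult Delta v) = vf_mult Delta v"
  by (cases v)
    (simp add: vf_part_eq_iff homogeneous_Delta_mult[simplified] del: vf_part.simps)

lemma homogeneous_var_z_power: "homogeneous i (var_z ^ i)"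
proof (induction i)
  case 0
  show ?case by (auto simp: homogeneous_iff coeff3_def)
qed (simp add: homogeneous_var_mult)

lemma vf_part_generator:
  "vf_part (Suc i) (vf_mult (var_z ^ i) vfM) = vf_mult (var_z ^ i) vfM"
proof -
  have "var_z ^ i * (2 * var_y) = 2 * (var_y * var_z ^ i)" "var_z ^ i * var_z = var_z * var_z ^ i"
    by simp_all
  then show ?thesis
    unfolding vfM_def vf_mult.simps vf_part_eq_iff
    by (simp only: homogeneous_var_mult homogeneous_arith homogeneous_var_z_power mult_zero_right
        simp_thms)
qed

section \<open>Iterated brackets of z^i M and the fields B\<close>

abbreviation tower :: "nat \<Rightarrow> nat \<Rightarrow> vfield" where
  "tower i j \<equiv> (bracket vfN ^^ j) (vf_mult (var_z ^ i) vfM)"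

lemma tangent_div_free_tower: "tangent_div_free (tower i j)"
  by (induction j) (simp_all add: tangent_div_free_generator tangent_div_free_bracket_vfN)

lemma vf_part_tower: "vf_part (Suc i) (tower i j) = tower i j"
  by (induction j) (simp_all add: vf_part_generator vf_part_bracket_vfN)

text \<open>N(\<Delta>) = 0, so \<Delta> behaves as a constant for ad_N.\<close>

lemma bracket_vfN_Delta_mult:
  "bracket vfN (vf_mult Delta v) = vf_mult Delta (bracket vfN v)"
proof -
  have "lie_N (Delta * f) = Delta * lie_N f" for f
    by (simp add: lie_N_def Delta_def power2_eq_square algebra_simps)
  then show ?thesis
    by (cases v) (simp add: bracket_vfN right_diff_distrib mult.left_commute[of _ 2]
        del: bracket.simps)
qed

lemma vf_scale_Delta_mult: "vf_scale c (vf_mult Delta v) = vf_mult Delta (vf_scale c v)"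
  by (cases v) (simp add: vf_scale_def algebra_simps)

lemma vfB_0: "vfB l i 0 = vf_scale (1 / kappa (nat (l + 1)) (2 * i + 2)) (tower i (nat (l + 1)))"
  by (simp add: vfB_def)

lemma vfB_Suc: "vfB l i (Suc k) = vf_mult Delta (vfB l i k)"
proof -
  have "vf_mult (var_z ^ i * Delta ^ Suc k) vfM = vf_mult Delta (vf_mult (var_z ^ i * Delta ^ k) vfM)"
    by (simp add: vfM_def algebra_simps)
  moreover have "(bracket vfN ^^ j) (vf_mult Delta v) = vf_mult Delta ((bracket vfN ^^ j) v)" for j v
    by (induction j) (simp_all add: bracket_vfN_Delta_mult)
  ultimately show ?thesis
    by (simp add: vfB_def vf_scale_Delta_mult)
qed

lemma tangent_div_free_vfB: "tangent_div_free (vfB l i k)"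
  by (induction k)
    (simp_all add: vfB_0 vfB_Suc tangent_div_free_tower tangent_div_free_scale
      tangent_div_free_Delta_mult)

lemma vf_part_vfB: "vf_part (i + 2 * k + 1) (vfB l i k) = vfB l i k"
proof (induction k)
  case 0
  show ?case by (simp add: vfB_0 vf_part_arith vf_part_tower)
next
  case (Suc k)
  then show ?case using vf_part_Delta_mult[OF Suc] by (simp add: vfB_Suc)
qed

subsection \<open>Restriction to the cone\<close>

text \<open>The exponents of the monomials of degree \<open>n\<close> that restrict to s^(2n-m) t^m:
  the s-exponent is 2 p + q = 2 n - m.\<close>

definition cone_mono :: "nat \<Rightarrow> nat \<Rightarrow> (nat \<times> nat \<times> nat) set" where
  "cone_mono n m = {(p, q, r). p + q + r = n \<and> q + 2 * r = m}"

text \<open>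
  The coefficient of \<open>s^(2n-m) t^m\<close> in \<open>f(s^2, s t, t^2)\<close>, the restriction of \<open>f\<close>
  to the cone \<open>\<Delta> = 0\<close>.
\<close>

definition cone_coeff :: "nat \<Rightarrow> nat \<Rightarrow> series \<Rightarrow> real" where
  "cone_coeff n m f = (\<Sum>(p, q, r)\<in>cone_mono n m. coeff3 f p q r)"

lemma finite_cone_mono [simp]: "finite (cone_mono n m)"
  by (rule finite_subset[of _ "{..n} \<times> {..n} \<times> {..n}"]) (auto simp: cone_mono_def)

lemma cone_coeff_arith [simp]:
  "cone_coeff n m 0 = 0"
  "cone_coeff n m (f + g) = cone_coeff n m f + cone_coeff n m g"
  "cone_coeff n m (f - g) = cone_coeff n m f - cone_coeff n m g"
  "cone_coeff n m (2 * f) = 2 * cone_coeff n m f"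
  "cone_coeff n m (const3 c * f) = c * cone_coeff n m f"
  by (simp_all add: cone_coeff_def split_def sum.distrib sum_subtractf sum_distrib_left)

lemma cone_coeff_sum: "cone_coeff n m (sum F A) = (\<Sum>j\<in>A. cone_coeff n m (F j))"
  by (induction A rule: infinite_finite_induct) simp_all

lemma cone_coeff_eq_0: "2 * n < m \<Longrightarrow> cone_coeff n m f = 0"
proof -
  assume "2 * n < m"
  then have "cone_mono n m = {}" by (auto simp: cone_mono_def)
  then show ?thesis by (simp add: cone_coeff_def)
qed

text \<open>Multiplication by x^a y^b z^c multiplies the restriction to the cone by s^(2a+b)
  t^(b+2c). The first assumption makes \<open>g\<close> divisible by this monomial, and
  \<open>w\<close> lists the coefficients of the quotient.\<close>

lemma cone_coeff_shift:
  assumes "\<And>p q r. coeff3 g p q r \<noteq> 0 \<Longrightarrow> a \<le> p \<and> b \<le> q \<and> c \<le> r"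
    and "\<And>p q r. coeff3 g (p + a) (q + b) (r + c) = w p q r"
  shows "cone_coeff (n + a + b + c) (m + b + 2 * c) g = (\<Sum>(p, q, r)\<in>cone_mono n m. w p q r)"
proof -
  let ?T = "{x \<in> cone_mono (n + a + b + c) (m + b + 2 * c).
    case x of (p, q, r) \<Rightarrow> a \<le> p \<and> b \<le> q \<and> c \<le> r}"
  have "cone_coeff (n + a + b + c) (m + b + 2 * c) g = (\<Sum>(p, q, r)\<in>?T. coeff3 g p q r)"
    unfolding cone_coeff_def by (rule sum.mono_neutral_right) (auto dest: assms(1))
  also have "\<dots> = (\<Sum>(p, q, r)\<in>cone_mono n m. w p q r)"
    by (rule sum.reindex_bij_witness[where
        i = "\<lambda>(p, q, r). (p + a, q + b, r + c)" and j = "\<lambda>(p, q, r). (p - a, q - b, r - c)"])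
      (auto simp: cone_mono_def assms(2)[symmetric])
  finally show ?thesis .
qed

lemma cone_coeff_var_mult:
  "cone_coeff (Suc n) m (var_x * f) = cone_coeff n m f"
  "cone_coeff (Suc n) (Suc m) (var_y * f) = cone_coeff n m f"
  "cone_coeff (Suc n) (Suc (Suc m)) (var_z * f) = cone_coeff n m f"
  using cone_coeff_shift[of "var_x * f" 1 0 0 "coeff3 f" n m]
    cone_coeff_shift[of "var_y * f" 0 1 0 "coeff3 f" n m]
    cone_coeff_shift[of "var_z * f" 0 0 1 "coeff3 f" n m]
  by (simp_all add: cone_coeff_def[of n m] Suc_le_eq split: if_splits)

text \<open>The restriction of y f is divisible by t, that of z f by t^2.\<close>

lemma cone_coeff_var_mult_0:
  "cone_coeff n 0 (var_y * f) = 0"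
  "cone_coeff n 0 (var_z * f) = 0"
  "cone_coeff n (Suc 0) (var_z * f) = 0"
  by (auto simp: cone_coeff_def cone_mono_def intro!: sum.neutral)

text \<open>
  In the reindexings below a monomial with vanishing contribution is sent to \<open>(0, 0, 0)\<close>,
  where the summand on the right is \<open>0\<close>: the rule asks for equal summands even there.
\<close>

lemma cone_coeff_lie_N: "cone_coeff n m (lie_N f) = real (Suc m) * cone_coeff n (Suc m) f"
proof -
  have 1: "cone_coeff n m (var_x * diff_y f)
      = (\<Sum>(p, q, r)\<in>cone_mono n (Suc m). real q * coeff3 f p q r)"
    unfolding cone_coeff_def
    by (rule sum.reindex_bij_witness_not_neutral[where S' = "cone_mono n m \<inter> {(p, q, r). p = 0}"
          and T' = "cone_mono n (Suc m) \<inter> {(p, q, r). q = 0}"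
          and i = "\<lambda>(p, q, r). (p + 1, q - 1, r)"
          and j = "\<lambda>(p, q, r). if p = 0 then (0, 0, 0) else (p - 1, q + 1, r)"])
      (simp, simp, auto simp: cone_mono_def)
  have 2: "cone_coeff n m (var_y * diff_z f)
      = (\<Sum>(p, q, r)\<in>cone_mono n (Suc m). real r * coeff3 f p q r)"
    unfolding cone_coeff_def
    by (rule sum.reindex_bij_witness_not_neutral[where S' = "cone_mono n m \<inter> {(p, q, r). q = 0}"
          and T' = "cone_mono n (Suc m) \<inter> {(p, q, r). r = 0}"
          and i = "\<lambda>(p, q, r). (p, q + 1, r - 1)"
          and j = "\<lambda>(p, q, r). if q = 0 then (0, 0, 0) else (p, q - 1, r + 1)"])
      (simp, simp, auto simp: cone_mono_def)
  \<comment> \<open>The weights from the two summands of N add up to the t-exponent q + 2 r = m + 1,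
    the factor produced by s d/dt.\<close>
  have 3: "real q * a + 2 * (real r * a) = real (Suc m) * a"
    if "(p, q, r) \<in> cone_mono n (Suc m)" for p q r a
  proof -
    have "real (Suc m) = real q + 2 * real r"
      using that by (simp add: cone_mono_def)
    then show ?thesis by (simp only: distrib_right mult.assoc)
  qed
  show ?thesis
    unfolding lie_N_def cone_coeff_arith 1 2 cone_coeff_def[of n "Suc m"]
      sum_distrib_left sum.distrib[symmetric]
    by (rule sum.cong) (auto simp: 3 simp del: of_nat_Suc)
qed

text \<open>On the cone M acts as t d/ds, which turns s^(2n-m) t^m into (2n-m) s^(2n-m-1)
  t^(m+1).\<close>

lemma cone_coeff_lie_M:
  "cone_coeff n (Suc m) (lie_M f) = (2 * real n - real m) * cone_coeff n m f"
proof -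
  have 1: "cone_coeff n (Suc m) (var_z * diff_y f)
      = (\<Sum>(p, q, r)\<in>cone_mono n m. real q * coeff3 f p q r)"
    unfolding cone_coeff_def
    by (rule sum.reindex_bij_witness_not_neutral[where
          S' = "cone_mono n (Suc m) \<inter> {(p, q, r). r = 0}"
          and T' = "cone_mono n m \<inter> {(p, q, r). q = 0}"
          and i = "\<lambda>(p, q, r). (p, q - 1, r + 1)"
          and j = "\<lambda>(p, q, r). if r = 0 then (0, 0, 0) else (p, q + 1, r - 1)"])
      (simp, simp, auto simp: cone_mono_def)
  have 2: "cone_coeff n (Suc m) (var_y * diff_x f)
      = (\<Sum>(p, q, r)\<in>cone_mono n m. real p * coeff3 f p q r)"
    unfolding cone_coeff_def
    by (rule sum.reindex_bij_witness_not_neutral[where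
          S' = "cone_mono n (Suc m) \<inter> {(p, q, r). q = 0}"
          and T' = "cone_mono n m \<inter> {(p, q, r). p = 0}"
          and i = "\<lambda>(p, q, r). (p - 1, q + 1, r)"
          and j = "\<lambda>(p, q, r). if q = 0 then (0, 0, 0) else (p + 1, q - 1, r)"])
      (simp, simp, auto simp: cone_mono_def)
  have 3: "real q * a + 2 * (real p * a) = (2 * real n - real m) * a"
    if "(p, q, r) \<in> cone_mono n m" for p q r a
  proof -
    have "2 * real n - real m = real q + 2 * real p"
      using that by (auto simp: cone_mono_def)
    then show ?thesis by (simp only: distrib_right mult.assoc)
  qed
  show ?thesis
    unfolding lie_M_def cone_coeff_arith 1 2 cone_coeff_def[of n m]
      sum_distrib_left sum.distrib[symmetric]
    by (rule sum.cong) (auto simp: 3 simp del: of_nat_Suc)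
qed

text \<open>Add the y-derivative of v(\<Delta>) = z f - 2 y g + x h = 0 to 2 y div v = 0; the terms
  with the y-derivative of g cancel.\<close>

lemma tangent_div_free_lie_eq:
  assumes "tangent_div_free (f, g, h)"
  shows "lie_M f + lie_N h = 2 * g"
proof -
  have "diff_y (vf_apply (f, g, h) Delta) = 0" and div: "divergence (f, g, h) = 0"
    using assms by (simp_all add: tangent_div_free_def del: vf_apply.simps divergence.simps)
  then have 1: "var_z * diff_y f - 2 * (var_y * diff_y g) - 2 * g + var_x * diff_y h = 0"
    by (simp add: vf_apply_Delta algebra_simps del: vf_apply.simps)
  have "2 * (var_y * diff_x f) + 2 * (var_y * diff_y g) + 2 * (var_y * diff_z h)
      = 2 * (var_y * divergence (f, g, h))"
    by (simp add: distrib_left)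
  then have 2: "2 * (var_y * diff_x f) + 2 * (var_y * diff_y g) + 2 * (var_y * diff_z h) = 0"
    unfolding div by simp
  have "lie_M f + lie_N h - 2 * g =
      (var_z * diff_y f - 2 * (var_y * diff_y g) - 2 * g + var_x * diff_y h) +
      (2 * (var_y * diff_x f) + 2 * (var_y * diff_y g) + 2 * (var_y * diff_z h))"
    unfolding lie_M_def lie_N_def by (simp only: algebra_simps)
  then show ?thesis unfolding 1 2 by simp
qed

section \<open>Relations between the three components on the cone\<close>

context
  fixes f g h :: series and n :: nat
  assumes tdf: "tangent_div_free (f, g, h)"
begin

text \<open>On the cone v(\<Delta>) = 0 reads t^2 f - 2 s t g + s^2 h = 0. Comparing powers of t
  expresses h through f and g.\<close>

lemma cone_coeff_tangency:
  "cone_coeff n 0 h = 0"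
  "cone_coeff n (Suc 0) h = 2 * cone_coeff n 0 g"
  "cone_coeff n (Suc (Suc m)) h = 2 * cone_coeff n (Suc m) g - cone_coeff n m f"
proof -
  have "cone_coeff (Suc n) k (vf_apply (f, g, h) Delta) = 0" for k
    using tdf by (simp add: tangent_div_free_def del: vf_apply.simps)
  then have *: "cone_coeff (Suc n) k (var_z * f) - 2 * cone_coeff (Suc n) k (var_y * g)
      + cone_coeff n k h = 0" for k
    by (simp add: vf_apply_Delta cone_coeff_var_mult del: vf_apply.simps)
  show "cone_coeff n 0 h = 0"
    "cone_coeff n (Suc 0) h = 2 * cone_coeff n 0 g"
    "cone_coeff n (Suc (Suc m)) h = 2 * cone_coeff n (Suc m) g - cone_coeff n m f"
    using *[of 0] *[of "Suc 0"] *[of "Suc (Suc m)"]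
    by (simp_all add: cone_coeff_var_mult cone_coeff_var_mult_0)
qed

text \<open>Compare M f + N h = 2 g at t^(m+1) and eliminate h by tangency. Thus f determines g on
  the cone up to the coefficient of t^0.\<close>

lemma cone_coeff_y_component:
  "real (Suc m) * cone_coeff n (Suc m) g = (real (Suc m) - real n) * cone_coeff n m f"
proof -
  have "cone_coeff n (Suc m) (lie_M f + lie_N h) = cone_coeff n (Suc m) (2 * g)"
    by (simp only: tangent_div_free_lie_eq[OF tdf])
  then have "(2 * real n - real m) * cone_coeff n m f
      + real (Suc (Suc m)) * (2 * cone_coeff n (Suc m) g - cone_coeff n m f)
      = 2 * cone_coeff n (Suc m) g"
    by (simp only: cone_coeff_arith cone_coeff_lie_M cone_coeff_lie_N cone_coeff_tangency)
  then show ?thesis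
    by (simp add: algebra_simps)
qed

lemma cone_coeff_vanish:
  assumes f: "\<And>m. m < 2 * n \<Longrightarrow> cone_coeff n m f = 0" and g: "cone_coeff n 0 g = 0"
  shows "cone_coeff n m f = 0" "cone_coeff n m g = 0" "cone_coeff n m h = 0"
proof -
  \<comment> \<open>At m = 2 n the left side of the relation is out of range, while the factor 2 n +
    1 - n on the right is nonzero.\<close>
  have "cone_coeff n (2 * n) f = 0"
    using cone_coeff_y_component[of "2 * n"] by (simp add: cone_coeff_eq_0)
  then show f': "cone_coeff n m f = 0" for m
    using f[of m] cone_coeff_eq_0[of n m f] by (cases m "2 * n" rule: linorder_cases) auto
  show g': "cone_coeff n m g = 0" for m
    using cone_coeff_y_component[of "m - 1"] g f' by (cases m) auto
  show "cone_coeff n m h = 0"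
    using cone_coeff_tangency f' g' by (cases m rule: nat.exhaust; cases "m - 1") auto
qed

end

text \<open>The kernel of restriction to the cone is generated by \<Delta>; the quotient is written
  down coefficient by coefficient.\<close>

lemma Delta_factor:
  assumes f: "homogeneous n f" and cone: "\<And>m. cone_coeff n m f = 0"
  shows "\<exists>g. f = Delta * g \<and> (\<forall>p q r. coeff3 g p q r \<noteq> 0 \<longrightarrow> p + q + r + 2 = n)"
proof -
  \<comment> \<open>The equation f = (x z - y^2) g forces a recursion along the chains that trade x
    z for y^2. Partial sums of the coefficients of f along such a chain solve it.\<close>
  define S where "S p q r = (\<Sum>j\<le>min p r. coeff3 f (p - j) (q + 2 * j) (r - j))" for p q r
  define g where "g = Abs_fps (\<lambda>r. Abs_fps (\<lambda>q. Abs_fps (\<lambda>p. - S p (q + 2) r)))"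
  have g: "coeff3 g p q r = - S p (q + 2) r" for p q r
    by (simp add: coeff3_def g_def)
  have S_rec: "S p q r = coeff3 f p q r + (if p = 0 \<or> r = 0 then 0 else S (p - 1) (q + 2) (r - 1))"
    for p q r
    by (cases p; cases r) (simp_all add: S_def sum.atMost_Suc_shift del: sum.atMost_Suc)
  \<comment> \<open>A chain that starts at q < 2 runs through all monomials with the same
    restriction, so its sum is a full cone coefficient. This gives the equation where y^2 does not
    divide the monomial.\<close>
  have S_0: "S p q r = 0" if "q < 2" for p q r
  proof -
    have "S p q r = cone_coeff (p + q + r) (q + 2 * r) f"
      unfolding S_def cone_coeff_def
      by (rule sum.reindex_bij_witness[where j = "\<lambda>j. (p - j, q + 2 * j, r - j)"
            and i = "\<lambda>(p', q', r'). r - r'"])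
        (use that in \<open>auto simp: cone_mono_def\<close>)
    also have "\<dots> = 0"
    proof (cases "p + q + r = n")
      case False
      then show ?thesis
        using f by (auto simp: cone_coeff_def cone_mono_def homogeneous_iff intro!: sum.neutral)
    qed (simp add: cone)
    finally show ?thesis .
  qed
  have "f = var_x * (var_z * g) - var_y * (var_y * g)"
  proof (rule series_eqI)
    fix p q r
    show "coeff3 f p q r = coeff3 (var_x * (var_z * g) - var_y * (var_y * g)) p q r"
      using S_rec[of p q r] S_0[of q p r] by (cases q; cases "q - 1") (auto simp: g)
  qed
  moreover have "p + q + r + 2 = n" if "coeff3 g p q r \<noteq> 0" for p q r
  proof -
    have "\<exists>j\<le>min p r. coeff3 f (p - j) (q + 2 + 2 * j) (r - j) \<noteq> 0"
      using that unfolding g S_def by (metis (no_types, lifting) atMost_iff neg_0_equal_iff_equal sum.neutral)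
    then obtain j where "j \<le> min p r" "coeff3 f (p - j) (q + 2 + 2 * j) (r - j) \<noteq> 0" by blast
    moreover from this have "(p - j) + (q + 2 + 2 * j) + (r - j) = n"
      using f unfolding homogeneous_iff by blast
    ultimately show ?thesis by simp
  qed
  ultimately show ?thesis
    by (intro exI[of _ g]) (simp add: Delta_def power2_eq_square algebra_simps)
qed

text \<open>
  A divergence-free field of degree \<open>n\<close> tangent to the level sets of \<open>\<Delta>\<close> is determined
  modulo \<open>\<Delta>\<close> by these \<open>2 n + 1\<close> numbers, and \<open>tower (n - 1) j\<close> has only the \<open>j\<close>-th one
  nonzero.
\<close>

definition cone_coord :: "nat \<Rightarrow> nat \<Rightarrow> vfield \<Rightarrow> real" where
  "cone_coord n j v =
     (if j < 2 * n then cone_coeff n (2 * n - 1 - j) (fst v) else cone_coeff n 0 (fst (snd v)))"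

lemma cone_coord_arith:
  "cone_coord n j (u - v) = cone_coord n j u - cone_coord n j v"
  "cone_coord n j (vf_scale c v) = c * cone_coord n j v"
  by (cases u; cases v; simp add: cone_coord_def vf_scale_def)+

lemma cone_coord_sum: "cone_coord n j (sum F A) = (\<Sum>a\<in>A. cone_coord n j (F a))"
  by (simp add: cone_coord_def fst_sum snd_sum cone_coeff_sum)

text \<open>Vanishing coordinates make all three components vanish on the cone, hence divisible by
  \<Delta>. The degree of \<open>w\<close> is stated through n = m + 2 to avoid truncated
  subtraction; for n < 2 no degree is left.\<close>

lemma tangent_div_free_Delta_factor:
  assumes v: "tangent_div_free v" "vf_part n v = v"
    and coord: "\<And>j. j \<le> 2 * n \<Longrightarrow> cone_coord n j v = 0"
  obtains w where "v = vf_mult Delta w" "tangent_div_free w"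
    "\<forall>m. n = m + 2 \<longrightarrow> vf_part m w = w" "n < 2 \<longrightarrow> w = 0"
proof -
  obtain f g h where fgh: "v = (f, g, h)" by (cases v)
  have "cone_coeff n m f = 0" if "m < 2 * n" for m
    using coord[of "2 * n - 1 - m"] that by (simp add: cone_coord_def fgh)
  moreover have "cone_coeff n 0 g = 0"
    using coord[of "2 * n"] by (simp add: cone_coord_def fgh)
  ultimately have "cone_coeff n m f = 0" "cone_coeff n m g = 0" "cone_coeff n m h = 0" for m
    using cone_coeff_vanish v(1) unfolding fgh by blast+
  moreover have "homogeneous n f" "homogeneous n g" "homogeneous n h"
    using v(2) unfolding fgh vf_part_eq_iff by auto
  ultimately obtain f' g' h'
    where fgh': "f = Delta * f'" "g = Delta * g'" "h = Delta * h'"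
      and deg: "\<forall>p q r. coeff3 f' p q r \<noteq> 0 \<longrightarrow> p + q + r + 2 = n"
        "\<forall>p q r. coeff3 g' p q r \<noteq> 0 \<longrightarrow> p + q + r + 2 = n"
        "\<forall>p q r. coeff3 h' p q r \<noteq> 0 \<longrightarrow> p + q + r + 2 = n"
    using Delta_factor[of n f] Delta_factor[of n g] Delta_factor[of n h] by blast
  show thesis
  proof
    show v': "v = vf_mult Delta (f', g', h')" by (simp add: fgh fgh')
    show "tangent_div_free (f', g', h')"
      using v(1) unfolding v' tangent_div_free_Delta_mult .
    show "\<forall>m. n = m + 2 \<longrightarrow> vf_part m (f', g', h') = (f', g', h')"
      unfolding vf_part_eq_iff homogeneous_iff using deg by (metis add_right_cancel)
    show "n < 2 \<longrightarrow> (f', g', h') = 0"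
      unfolding zero_prod_def using deg by (auto intro!: series_eqI)
  qed
qed

section \<open>Cone coordinates of the iterated brackets\<close>

lemma cone_coeff_var_z_power: "cone_coeff i m (var_z ^ i) = (if m = 2 * i then 1 else 0)"
proof (induction i arbitrary: m)
  case 0
  have "cone_mono 0 m = (if m = 0 then {(0, 0, 0)} else {})"
    by (auto simp: cone_mono_def)
  then show ?case by (simp add: cone_coeff_def coeff3_def)
next
  case (Suc i)
  consider "m = 0" | "m = Suc 0" | m' where "m = Suc (Suc m')"
    by (metis nat.exhaust)
  then show ?case
    by cases (simp_all add: cone_coeff_var_mult cone_coeff_var_mult_0 Suc)
qed

lemma fst_bracket_vfN:
  "fst (bracket vfN v) = lie_N (fst v)" "fst (snd (bracket vfN v)) = lie_N (fst (snd v)) - fst v"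
  by (cases v; simp add: bracket_vfN del: bracket.simps)+

text \<open>The first component of z^i M is 2 y z^i, which restricts to 2 s t^(2i+1). Each bracket
  applies s d/dt to it, and the exponents brought down form the Pochhammer product.\<close>

lemma cone_coeff_fst_tower:
  "cone_coeff (Suc i) m (fst (tower i j)) =
     (if m + j = 2 * i + 1 then 2 * pochhammer (real (Suc m)) j else 0)"
proof (induction j arbitrary: m)
  case 0
  have "fst (tower i 0) = 2 * (var_y * var_z ^ i)"
    by (simp add: vfM_def)
  then show ?case
    by (cases m) (simp_all add: cone_coeff_var_mult cone_coeff_var_mult_0 cone_coeff_var_z_power)
next
  case (Suc j)
  have "cone_coeff (Suc i) m (fst (tower i (Suc j)))
      = real (Suc m) * cone_coeff (Suc i) (Suc m) (fst (tower i j))"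
    by (simp only: funpow.simps o_apply fst_bracket_vfN cone_coeff_lie_N)
  then show ?case
    by (simp add: Suc.IH pochhammer_rec add.commute)
qed

text \<open>The matrix of coordinates is diagonal with nonzero diagonal. The coordinates taken from
  the first component follow from the monomial just computed; the last one needs the second
  component.\<close>

lemma cone_coord_tower:
  assumes "j \<le> 2 * Suc i" "k \<le> 2 * Suc i"
  shows "cone_coord (Suc i) j (tower i k) = 0 \<longleftrightarrow> j \<noteq> k"
proof (cases "j < 2 * Suc i")
  case True
  have "cone_coeff (Suc i) m (fst (tower i k)) = 0 \<longleftrightarrow> m + k \<noteq> 2 * i + 1" for m
    using pochhammer_pos[of "real (Suc m)" k] unfolding cone_coeff_fst_tower by auto
  with True show ?thesis
    by (auto simp: cone_coord_def)
next
  case False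
  have "cone_coeff (Suc i) 0 (fst (snd (tower i k))) = 0 \<longleftrightarrow> k \<noteq> 2 * Suc i"
  proof (cases k)
    case 0
    then show ?thesis
      by (simp add: vfM_def cone_coeff_var_mult_0 mult.commute[of _ var_z])
  next
    case (Suc k')
    obtain f g h where fgh: "tower i k' = (f, g, h)" by (cases "tower i k'")
    have "tangent_div_free (f, g, h)"
      using tangent_div_free_tower[of k' i] by (simp only: fgh)
    \<comment> \<open>With n = i + 1, the t^0 coefficient of N g - f is g_1 - f_0, where g_1 = (1 -
      n) f_0. The result -n f_0 is nonzero only for k' = 2 i + 1.\<close>
    note cone_coeff_y_component[OF this, where n = "Suc i" and m = 0]
    then have "cone_coeff (Suc i) 0 (fst (snd (tower i k)))
        = - real (Suc i) * cone_coeff (Suc i) 0 (fst (tower i k'))"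
      unfolding Suc funpow.simps o_apply fst_bracket_vfN cone_coeff_arith cone_coeff_lie_N
      by (simp add: fgh algebra_simps)
    moreover have "pochhammer 1 k' \<noteq> (0 :: real)"
      using pochhammer_pos[of "1 :: real" k'] by simp
    ultimately show ?thesis
      by (auto simp: cone_coeff_fst_tower Suc simp del: funpow.simps)
  qed
  with False assms show ?thesis
    by (auto simp: cone_coord_def)
qed

subsection \<open>Spanning and formal sums\<close>

text \<open>The indices of the fields B of degree \<open>n\<close>. Unlike \<open>B_index\<close>
  this includes degree one, where i = k = 0 and l is -1, 0 or 1.\<close>

definition B_level :: "nat \<Rightarrow> (int \<times> nat \<times> nat) set" where
  "B_level n = {(l, i, k). i + 2 * k + 1 = n \<and> -1 \<le> l \<and> l \<le> 2 * int i + 1}"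

lemma finite_B_level: "finite (B_level n)"
  by (rule finite_subset[of _ "{-1..2 * int n + 1} \<times> {..n} \<times> {..n}"]) (auto simp: B_level_def)

lemma tangent_div_free_reduce:
  assumes v: "tangent_div_free v" "vf_part (Suc i) v = v"
  obtains c w where "v = (\<Sum>j\<le>2 * Suc i. vf_scale (c j) (tower i j)) + vf_mult Delta w"
    "tangent_div_free w" "\<forall>m. i = Suc m \<longrightarrow> vf_part m w = w" "i = 0 \<longrightarrow> w = 0"
proof -
  \<comment> \<open>Only \<open>tower i j\<close> contributes to the j-th coordinate, so this
    quotient is the coefficient that removes that coordinate from v.\<close>
  define c where "c j = cone_coord (Suc i) j v / cone_coord (Suc i) j (tower i j)" for j
  define s where "s = (\<Sum>j\<le>2 * Suc i. vf_scale (c j) (tower i j))"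
  have "tangent_div_free (v - s)"
    unfolding s_def by (intro tangent_div_free_diff tangent_div_free_sum tangent_div_free_scale
        tangent_div_free_tower v)
  moreover have "vf_part (Suc i) (v - s) = v - s"
    unfolding s_def by (simp only: vf_part_arith vf_part_sum vf_part_tower v)
  moreover have "cone_coord (Suc i) j (v - s) = 0" if j: "j \<le> 2 * Suc i" for j
  proof -
    have "cone_coord (Suc i) j s =
        (\<Sum>k\<le>2 * Suc i. if k = j then c j * cone_coord (Suc i) j (tower i j) else 0)"
      unfolding s_def cone_coord_sum cone_coord_arith
      by (intro sum.cong refl) (use j cone_coord_tower[of j i] in auto)
    also have "\<dots> = cone_coord (Suc i) j v"
      using j cone_coord_tower[of j i j] by (simp add: c_def)
    finally show ?thesis by (simp add: cone_coord_arith)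
  qed
  ultimately obtain w where "v - s = vf_mult Delta w" "tangent_div_free w"
    "\<forall>m. Suc i = m + 2 \<longrightarrow> vf_part m w = w" "Suc i < 2 \<longrightarrow> w = 0"
    by (rule tangent_div_free_Delta_factor)
  moreover from this(1) have "v = s + vf_mult Delta w"
    by (metis add.commute diff_add_cancel)
  ultimately show thesis
    by (intro that[of c w]) (simp_all add: s_def)
qed

lemma vf_scale_vf_scale: "vf_scale a (vf_scale b v) = vf_scale (a * b) v"
  by (cases v) (simp add: vf_scale_def const3_def flip: mult.assoc)

lemma vf_scale_1: "vf_scale 1 v = v"
  by (cases v) (simp add: vf_scale_def const3_def)

lemma vf_mult_0: "vf_mult u 0 = 0"
  by (simp add: zero_prod_def)

lemma vf_mult_sum: "vf_mult u (sum F A) = (\<Sum>a\<in>A. vf_mult u (F a))"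
proof -
  have "vf_mult u (v + w) = vf_mult u v + vf_mult u w" for v w
    by (cases v; cases w) (simp add: distrib_left)
  then show ?thesis by (induction A rule: infinite_finite_induct) (simp_all add: vf_mult_0)
qed

lemma tower_eq_vfB:
  "tower i j = vf_scale (kappa j (2 * i + 2)) (vfB (int j - 1) i 0)"
proof -
  have "kappa j (2 * i + 2) \<noteq> 0" by (simp add: kappa_def)
  then show ?thesis by (simp add: vfB_0 vf_scale_vf_scale vf_scale_1)
qed

text \<open>Strong induction, since splitting off \<Delta> lowers the degree by two. The towers
  supply the fields with k = 0, and multiplication by \<Delta> raises k by one in the rest.\<close>

lemma homogeneous_spanned_by_vfB:
  assumes "tangent_div_free v" "vf_part n v = v"
  shows "\<exists>b. v = (\<Sum>(l, i, k)\<in>B_level n. vf_scale (b l i k) (vfB l i k))"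
  using assms
proof (induction n arbitrary: v rule: less_induct)
  case (less n)
  show ?case
  proof (cases n)
    case 0
    obtain f g h where fgh: "v = (f, g, h)" by (cases v)
    \<comment> \<open>In degree 0 this is the only coordinate. Tangency equates twice its value with
      a coefficient of h that is out of range.\<close>
    have "cone_coeff 0 0 g = 0"
      using cone_coeff_tangency(2)[of f g h 0] less.prems(1) cone_coeff_eq_0[of 0 1 h]
      by (simp add: fgh)
    then obtain w where "v = vf_mult Delta w" "w = 0"
      using tangent_div_free_Delta_factor[OF less.prems] 0
      by (auto simp: cone_coord_def fgh)
    moreover have "B_level n = {}" by (auto simp: B_level_def 0)
    ultimately show ?thesis by (simp add: vf_mult_0)
  next
    case (Suc i)
    have part: "vf_part (Suc i) v = v" using less.prems(2) Suc by simp
    obtain c w where v: "v = (\<Sum>j\<le>2 * Suc i. vf_scale (c j) (tower i j)) + vf_mult Delta w"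
      and w: "tangent_div_free w" "\<forall>m. i = Suc m \<longrightarrow> vf_part m w = w" "i = 0 \<longrightarrow> w = 0"
      by (rule tangent_div_free_reduce[OF less.prems(1) part])
    \<comment> \<open>For i = 0 the truncated i - 1 is harmless: \<open>B_level 0\<close> is empty
      and w = 0.\<close>
    have "\<exists>b. w = (\<Sum>(l, i', k)\<in>B_level (i - 1). vf_scale (b l i' k) (vfB l i' k))"
    proof (cases i)
      case 0
      have "B_level 0 = {}" by (auto simp: B_level_def)
      then show ?thesis using 0 by (simp add: w(3))
    next
      case (Suc m)
      then show ?thesis using less.IH[of m w] w \<open>n = Suc i\<close> by simp
    qed
    then obtain b where w_eq: "w = (\<Sum>(l, i', k)\<in>B_level (i - 1). vf_scale (b l i' k) (vfB l i' k))" ..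
    \<comment> \<open>The entries with k = 0 come from the towers, \<open>kappa\<close> undoing the
      normalisation of B; the others are those of w with k shifted by one.\<close>
    define b' where "b' l i' k =
      (case k of 0 \<Rightarrow> c (nat (l + 1)) * kappa (nat (l + 1)) (2 * i + 2) | Suc k' \<Rightarrow> b l i' k')"
      for l i' k
    let ?F = "\<lambda>(l, i', k). vf_scale (b' l i' k) (vfB l i' k)"
    let ?L = "{-1..2 * int i + 1} \<times> {i} \<times> {0 :: nat}"
    let ?R = "(\<lambda>(l, i', k). (l, i', Suc k)) ` B_level (i - 1)"
    have level: "B_level n = ?L \<union> ?R"
    proof (intro equalityI subsetI)
      fix x assume "x \<in> B_level n"
      then show "x \<in> ?L \<union> ?R"
        by (cases x; cases "snd (snd x)") (auto simp: B_level_def Suc image_iff)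
    qed (auto simp: B_level_def Suc)
    have "(\<Sum>x\<in>?L. ?F x) = (\<Sum>j\<le>2 * Suc i. vf_scale (c j) (tower i j))"
      by (rule sum.reindex_bij_witness[where i = "\<lambda>j. (int j - 1, i, 0)" and j = "\<lambda>(l, _). nat (l + 1)"])
        (auto simp: b'_def tower_eq_vfB vf_scale_vf_scale)
    moreover have "(\<Sum>x\<in>?R. ?F x) = vf_mult Delta w"
      unfolding w_eq vf_mult_sum
      by (subst sum.reindex)
        (auto simp: inj_on_def b'_def vfB_Suc vf_scale_Delta_mult intro!: sum.cong)
    moreover have "(\<Sum>x\<in>B_level n. ?F x) = (\<Sum>x\<in>?L. ?F x) + (\<Sum>x\<in>?R. ?F x)"
      unfolding level by (rule sum.union_disjoint) (auto simp: finite_B_level)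
    ultimately have "v = (\<Sum>x\<in>B_level n. ?F x)"
      by (simp only: v)
    then show ?thesis by blast
  qed
qed

section \<open>Formal sums of homogeneous families\<close>

lemma series_has_sum_homogeneous:
  assumes F: "\<And>j. j \<in> I \<Longrightarrow> homogeneous (deg j) (F j)"
    and fin: "\<And>n. finite {j \<in> I. deg j = n}"
  shows "series_has_sum F I s \<longleftrightarrow> (\<forall>n. series_part n s = (\<Sum>j | j \<in> I \<and> deg j = n. F j))"
proof -
  have deg: "deg j = p + q + r" if "j \<in> I" "coeff3 (F j) p q r \<noteq> 0" for j p q r
    using F that unfolding homogeneous_iff by metis
  have sub: "{j \<in> I. coeff3 (F j) p q r \<noteq> 0} \<subseteq> {j \<in> I. deg j = p + q + r}" for p q r
    using deg by auto
  \<comment> \<open>Only members of degree p + q + r reach this coefficient, and they are finitely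
    many; adding those with coefficient 0 turns the sum into one over the whole degree.\<close>
  have sum_eq: "(\<Sum>j | j \<in> I \<and> coeff3 (F j) p q r \<noteq> 0. coeff3 (F j) p q r)
      = coeff3 (\<Sum>j | j \<in> I \<and> deg j = p + q + r. F j) p q r" for p q r
    unfolding coeff3_sum by (rule sum.mono_neutral_left) (use fin sub in auto)
  have "series_has_sum F I s \<longleftrightarrow>
      (\<forall>p q r. coeff3 s p q r = coeff3 (\<Sum>j | j \<in> I \<and> deg j = p + q + r. F j) p q r)"
    unfolding series_has_sum_def sum_eq using finite_subset[OF sub fin] by simp
  also have "\<dots> \<longleftrightarrow> (\<forall>n. series_part n s = (\<Sum>j | j \<in> I \<and> deg j = n. F j))"
  proof (intro iffI allI series_eqI)
    fix n p q r
    assume *: "\<forall>p q r. coeff3 s p q r = coeff3 (\<Sum>j | j \<in> I \<and> deg j = p + q + r. F j) p q r"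
    show "coeff3 (series_part n s) p q r = coeff3 (\<Sum>j | j \<in> I \<and> deg j = n. F j) p q r"
    proof (cases "p + q + r = n")
      case True
      with * show ?thesis by simp
    next
      case False
      then have "(\<Sum>j | j \<in> I \<and> deg j = n. coeff3 (F j) p q r) = 0"
        using deg by (intro sum.neutral) (metis (mono_tags, lifting) mem_Collect_eq)
      with False show ?thesis by (simp add: coeff3_sum)
    qed
  next
    fix p q r
    assume *: "\<forall>n. series_part n s = (\<Sum>j | j \<in> I \<and> deg j = n. F j)"
    show "coeff3 s p q r = coeff3 (\<Sum>j | j \<in> I \<and> deg j = p + q + r. F j) p q r"
      using *[rule_format, symmetric, of "p + q + r"] by simp
  qed
  finally show ?thesis .
qed

lemma vf_has_sum_homogeneous:
  assumes F: "\<And>j. j \<in> I \<Longrightarrow> vf_part (deg j) (F j) = F j"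
    and fin: "\<And>n. finite {j \<in> I. deg j = n}"
  shows "vf_has_sum F I v \<longleftrightarrow> (\<forall>n. vf_part n v = (\<Sum>j | j \<in> I \<and> deg j = n. F j))"
proof -
  have hom: "homogeneous (deg j) (fst (F j)) \<and> homogeneous (deg j) (fst (snd (F j)))
      \<and> homogeneous (deg j) (snd (snd (F j)))" if "j \<in> I" for j
    using F[OF that] unfolding vf_part_eq_iff[symmetric] by simp
  show ?thesis
    unfolding vf_has_sum_def
    by (subst (1 2 3) series_has_sum_homogeneous[where deg = deg])
      (use hom fin in \<open>auto simp: prod_eq_iff fst_sum snd_sum\<close>, (cases v; simp)+)
qed

text \<open>The condition i + 2 k \<ge> 1 in \<open>B_index\<close> leaves exactly the degrees i + 2
  k + 1 \<ge> 2, each with a finite level.\<close>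

lemma B_family_has_sum_iff:
  "vf_has_sum (\<lambda>(l, i, k). vf_scale (b l i k) (vfB l i k)) B_index w \<longleftrightarrow>
     vf_part 0 w = 0 \<and> vf_part 1 w = 0 \<and>
     (\<forall>n\<ge>2. vf_part n w = (\<Sum>(l, i, k)\<in>B_level n. vf_scale (b l i k) (vfB l i k)))"
proof -
  let ?deg = "\<lambda>(l :: int, i, k). i + 2 * k + 1"
  have level: "{j \<in> B_index. ?deg j = n} = (if n < 2 then {} else B_level n)" for n
    by (auto simp: B_index_def B_level_def)
  have "vf_has_sum (\<lambda>(l, i, k). vf_scale (b l i k) (vfB l i k)) B_index w \<longleftrightarrow>
     (\<forall>n. vf_part n w = (\<Sum>j | j \<in> B_index \<and> ?deg j = n.
        (\<lambda>(l, i, k). vf_scale (b l i k) (vfB l i k)) j))"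
  proof (rule vf_has_sum_homogeneous)
    show "finite {j \<in> B_index. ?deg j = n}" for n
      unfolding level by (simp add: finite_B_level)
    show "vf_part (?deg j) ((\<lambda>(l, i, k). vf_scale (b l i k) (vfB l i k)) j)
        = (\<lambda>(l, i, k). vf_scale (b l i k) (vfB l i k)) j" for j
      using vf_part_vfB by (cases j) (simp add: vf_part_arith)
  qed
  also have "\<dots> \<longleftrightarrow> vf_part 0 w = 0 \<and> vf_part 1 w = 0 \<and>
     (\<forall>n\<ge>2. vf_part n w = (\<Sum>(l, i, k)\<in>B_level n. vf_scale (b l i k) (vfB l i k)))"
    unfolding level
    by (auto simp: not_less) (metis One_nat_def less_2_cases not_less)
  finally show ?thesis .
qed

theorem theorem4p6:
  fixes v :: vfield
  assumes no_const: "vf_part 0 v = 0"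
    and linear: "\<exists>a::real. vf_part 1 v = vf_scale a vfN"
  shows "(divergence v = 0 \<and> vf_apply v Delta = 0) \<longleftrightarrow> v \<in> B_space"
proof
  assume "divergence v = 0 \<and> vf_apply v Delta = 0"
  then have "tangent_div_free v" by (simp add: tangent_div_free_def)
  then have "tangent_div_free (vf_part n v)" for n
    using tangent_div_free_iff_parts by blast
  then have "\<forall>n. \<exists>b. vf_part n v = (\<Sum>(l, i, k)\<in>B_level n. vf_scale (b l i k) (vfB l i k))"
    by (intro allI homogeneous_spanned_by_vfB) (simp_all add: vf_part_vf_part)
  from choice[OF this] obtain b where
    b: "\<forall>n. vf_part n v = (\<Sum>(l, i, k)\<in>B_level n. vf_scale (b n l i k) (vfB l i k))" ..
  \<comment> \<open>Spanning alone would allow all three fields of degree one; the hypothesis on the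
    linear part leaves only multiples of N.\<close>
  obtain a where a: "vf_part 1 v = vf_scale a vfN" using linear by blast
  define w where "w = v - vf_part 1 v"
  \<comment> \<open>The coefficients were chosen separately in each degree. They merge into one
    family because i and k determine the degree.\<close>
  have "vf_has_sum (\<lambda>(l, i, k). vf_scale (b (i + 2 * k + 1) l i k) (vfB l i k)) B_index w"
    unfolding B_family_has_sum_iff
  proof (intro conjI allI impI)
    fix n :: nat assume "2 \<le> n"
    then have "vf_part n w = vf_part n v"
      by (simp add: w_def vf_part_arith vf_part_vf_part)
    then show "vf_part n w =
        (\<Sum>(l, i, k)\<in>B_level n. vf_scale (b (i + 2 * k + 1) l i k) (vfB l i k))"
      unfolding b[rule_format, of n] by (auto simp: B_level_def intro!: sum.cong)
  qed (simp_all add: w_def vf_part_arith vf_part_vf_part no_const)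
  moreover have "vf_scale a vfN = vf_scale (- a) (vfB 1 0 0)"
    unfolding vfB_1_0_0 by (auto simp: vf_scale_def vfN_def intro!: series_eqI)
  then have "v = vf_scale (- a) (vfB 1 0 0) + w"
    by (simp add: w_def flip: a)
  ultimately show "v \<in> B_space"
    unfolding B_space_def mem_Collect_eq
    by (intro exI[of _ "- a"] exI[of _ "\<lambda>l i k. b (i + 2 * k + 1) l i k"] exI[of _ w] conjI)
next
  assume "v \<in> B_space"
  then obtain c b w where v: "v = vf_scale c (vfB 1 0 0) + w"
    and "vf_has_sum (\<lambda>(l, i, k). vf_scale (b l i k) (vfB l i k)) B_index w"
    unfolding B_space_def by blast
  then have w: "vf_part 0 w = 0" "vf_part 1 w = 0"
    "2 \<le> n \<Longrightarrow> vf_part n w = (\<Sum>(l, i, k)\<in>B_level n. vf_scale (b l i k) (vfB l i k))" for n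
    unfolding B_family_has_sum_iff by blast+
  \<comment> \<open>The sum may be infinite, but each homogeneous part is a finite combination of
    fields B, and the parts suffice.\<close>
  have "tangent_div_free (vf_part n w)" for n
  proof (cases "2 \<le> n")
    case True
    then show ?thesis
      by (auto simp: w intro!: tangent_div_free_sum tangent_div_free_scale tangent_div_free_vfB)
  next
    case False
    then have "n = 0 \<or> n = 1" by auto
    then show ?thesis using w by auto
  qed
  then have "tangent_div_free v"
    unfolding v using tangent_div_free_iff_parts
    by (blast intro: tangent_div_free_add tangent_div_free_scale tangent_div_free_vfB)
  then show "divergence v = 0 \<and> vf_apply v Delta = 0"
    by (simp add: tangent_div_free_def)
qed

end
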